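(* For every $n\ge1$, the André polynomial $S_n(x)$ satisfies $$S_n(x)=\sum_{T}G_T\;x^{\,n+1-\ell(\lambda(T))},$$ where the sum is over all standard Young tableaux $T\in\mathrm{SYT}(n)$ with at most two columns.
   Context: **André polynomials.** For a permutation $\pi$ of $\{1,\ldots,n\}$, a descent is an index $i\in\{1,\ldots,n\}$ with $\pi(i)>\pi(i+1)$ or $i=n$; $\mathrm{des}(\pi)$ is the number of descents (so the last index always counts). A word $w_1\cdots w_m$ has no double descents if there is no $i\in\{1,\ldots,m-2\}$ with $w_i>w_{i+1}>w_{i+2}$. A permutation $\pi\in\mathfrak S_n$ is simsun if for each $k\in\{1,\ldots,n\}$ the subword of $\pi$ consisting of the letters $1,\ldots,k$ (in the order they appear in $\pi$) has no double descents. $S_n(x)=\sum_{\pi}x^{\mathrm{des}(\pi)}$, summed over all simsun permutations in $\mathfrak S_n$; for example $S_1(x)=x$, $S_2(x)=x+x^2$, $S_3(x)=x+4x^2$. **Standard Young tableaux.** $\mathrm{SYT}(n)$ is the set of standard Young tableaux of size $n$, drawn with rows numbered from bottom to top: for a partition $\lambda=(\lambda_1\ge\lambda_2\ge\cdots)$ of $n$, row $r$ has $\lambda_r$ left-justified boxes, the boxes are filled with $1,\ldots,n$ each used once, rows increase from left to right and columns increase from bottom to top. $\lambda(T)$ is the shape of $T$ and $\ell(\lambda(T))$ is its number of nonzero parts (number of rows). **$g$-index.** To the left of $T\in\mathrm{SYT}(n)$ one adds a special column (column 0, not counted among the columns of $T$) of $n$ boxes in rows $1,\ldots,n$, the box in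 row $r$ containing the label $r$. If $v\in\{1,\ldots,n\}$ is in column $i\ge1$ and row $j\ge 1$ of $T$, $g_T(v)$ is the number of boxes in column $i-1$ and in rows $j'\ge j$ whose entry is less than or equal to $v$ (for $i=1$ the boxes counted are those of column 0). The $g$-index of $T$ is $G_T=g_T(1)g_T(2)\cdots g_T(n)$. *)

theory Defs
  imports
    "HOL-Combinatorics.Combinatorics"
    "HOL-Computational_Algebra.Polynomial"
begin

definition des :: "nat \<Rightarrow> (nat \<Rightarrow> nat) \<Rightarrow> nat" where
  "des n \<pi> = card {i \<in> {1..n}. \<pi> i > \<pi> (i + 1) \<or> i = n}"

definition no_double_descents :: "nat list \<Rightarrow> bool" where
  "no_double_descents w \<longleftrightarrow>
     (\<nexists>i. i + 2 < length w \<and> w ! i > w ! (i + 1) \<and> w ! (i + 1) > w ! (i + 2))"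

definition subword_upto :: "nat \<Rightarrow> (nat \<Rightarrow> nat) \<Rightarrow> nat \<Rightarrow> nat list" where
  "subword_upto n \<pi> k = filter (\<lambda>x. x \<le> k) (map \<pi> [1..<n + 1])"

definition simsun :: "nat \<Rightarrow> (nat \<Rightarrow> nat) \<Rightarrow> bool" where
  "simsun n \<pi> \<longleftrightarrow> \<pi> permutes {1..n} \<and>
     (\<forall>k \<in> {1..n}. no_double_descents (subword_upto n \<pi> k))"

definition andre_poly :: "nat \<Rightarrow> int poly" where
  "andre_poly n = (\<Sum>\<pi> | simsun n \<pi>. monom 1 (des n \<pi>))"

text \<open>
  A tableau is the list of its rows, from bottom to top. Boxes are pairs (row, column), both
  numbered from 1, whereas list positions start at 0.
\<close>

type_synonym tableau = "nat list list"

definition is_partition :: "nat \<Rightarrow> nat list \<Rightarrow> bool" where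
  "is_partition n \<mu> \<longleftrightarrow> sorted_wrt (\<ge>) \<mu> \<and> 0 \<notin> set \<mu> \<and> sum_list \<mu> = n"

definition shape :: "tableau \<Rightarrow> nat list" where
  "shape T = map length T"

definition boxes :: "tableau \<Rightarrow> (nat \<times> nat) set" where
  "boxes T = {(r, c). r \<in> {1..length T} \<and> c \<in> {1..length (T ! (r - 1))}}"

definition entry :: "tableau \<Rightarrow> nat \<times> nat \<Rightarrow> nat" where
  "entry T = (\<lambda>(r, c). T ! (r - 1) ! (c - 1))"

definition SYT :: "nat \<Rightarrow> tableau set" where
  "SYT n = {T. is_partition n (shape T) \<and>
     bij_betw (entry T) (boxes T) {1..n} \<and>
     (\<forall>r c c'. (r, c) \<in> boxes T \<and> (r, c') \<in> boxes T \<and> c < c'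
        \<longrightarrow> entry T (r, c) < entry T (r, c')) \<and>
     (\<forall>r r' c. (r, c) \<in> boxes T \<and> (r', c) \<in> boxes T \<and> r < r'
        \<longrightarrow> entry T (r, c) < entry T (r', c))}"

text \<open>The tableau together with the special column 0, whose box in row r contains r.\<close>

definition ext_boxes :: "nat \<Rightarrow> tableau \<Rightarrow> (nat \<times> nat) set" where
  "ext_boxes n T = {1..n} \<times> {0} \<union> boxes T"

definition ext_entry :: "tableau \<Rightarrow> nat \<times> nat \<Rightarrow> nat" where
  "ext_entry T = (\<lambda>(r, c). if c = 0 then r else entry T (r, c))"

definition box_of :: "tableau \<Rightarrow> nat \<Rightarrow> nat \<times> nat" where
  "box_of T v = (THE b. b \<in> boxes T \<and> entry T b = v)"

definition g_value :: "nat \<Rightarrow> tableau \<Rightarrow> nat \<Rightarrow> nat" where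
  "g_value n T v = (case box_of T v of (j, i) \<Rightarrow>
     card {j'. j' \<ge> j \<and> (j', i - 1) \<in> ext_boxes n T \<and> ext_entry T (j', i - 1) \<le> v})"

definition g_index :: "nat \<Rightarrow> tableau \<Rightarrow> nat" where
  "g_index n T = (\<Prod>v = 1..n. g_value n T v)"

definition at_most_two_columns :: "tableau \<Rightarrow> bool" where
  "at_most_two_columns T \<longleftrightarrow> (\<forall>row \<in> set T. length row \<le> 2)"

end

theory Submission imports Defs begin

text \<open>
  Both sides satisfy P(n+1) = x P(n)' + (n+2) x P(n) - 2 x^2 P(n)', which sends x^k to
  k x^k + (n+2-2k) x^(k+1). On simsun words with k descents, the letter n+1 may be inserted inside
  one of the k-1 inner descents or at the end without changing k; it may not be inserted right
  before one of the k-1 descent tops (this would create a double descent); the remaining n+2-2k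
  places add a descent. On two-column tableaux with columns of lengths a and b = n-a, so that
  k = n+1-a = b+1, adding the box n+1 to the first column multiplies the g-index by
  n+1-a = k, and adding it to the second column multiplies it by a-b = n+2-2k and raises k by one.
\<close>

section \<open>The linear operator of the common recursion\<close>

definition andre_step :: "nat \<Rightarrow> int poly \<Rightarrow> int poly" where
  "andre_step n p =
     monom 1 1 * pderiv p + monom (int n + 2) 1 * p - monom 2 2 * pderiv p"

text \<open>Linearity allows the recursion to be checked on one word, or one tableau, at a
  time.\<close>

lemma andre_step_sum: "andre_step n (\<Sum>a\<in>A. f a) = (\<Sum>a\<in>A. andre_step n (f a))"
  \<comment> \<open>The sum rule for \<open>pderiv\<close> is the first-order case of the rule for
    iterated derivatives.\<close>
  by (simp add: andre_step_def higher_pderiv_sum[of 1, simplified] sum_distrib_left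
      sum.distrib sum_subtractf)

text \<open>With k = d + 1 the weights k and n + 2 - 2k become d + 1 and n - 2d. Here d stands for
  the number of inner descents of a word, or for the length of a second column.\<close>

lemma andre_step_monom:
  "andre_step n (monom c (Suc d)) =
     monom (c * (int d + 1)) (Suc d) + monom (c * (int n - 2 * int d)) (Suc (Suc d))"
proof -
  have "andre_step n (monom c (Suc d)) = monom (c * (int d + 1)) (Suc d) +
      (monom ((int n + 2) * c) (Suc (Suc d)) - monom (2 * (c * (int d + 1))) (Suc (Suc d)))"
    by (simp add: andre_step_def pderiv_monom mult_monom mult.commute add.commute)
  also have "monom ((int n + 2) * c) (Suc (Suc d)) - monom (2 * (c * (int d + 1))) (Suc (Suc d))
      = monom (c * (int n - 2 * int d)) (Suc (Suc d))"
    by (subst diff_monom) (simp add: algebra_simps)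
  finally show ?thesis .
qed

section \<open>Simsun words\<close>

fun descents :: "nat list \<Rightarrow> nat" where
  "descents (x # y # zs) = (if x > y then 1 else 0) + descents (y # zs)"
| "descents _ = 0"

text \<open>Links the recursive form, suited to concatenation, with the set of descent positions,
  from which insertion places are counted.\<close>

lemma descents_conv_card: "descents w = card {i. Suc i < length w \<and> w ! i > w ! Suc i}"
proof (induction w rule: descents.induct)
  case (1 x y zs)
  let ?D = "\<lambda>w. {i. Suc i < length w \<and> w ! i > w ! Suc i}"
  have fin: "finite (?D w)" for w
    by (rule finite_subset[of _ "{..length w}"]) auto
  have "?D (x # y # zs) = (if x > y then {0} else {}) \<union> Suc ` ?D (y # zs)"
  proof (rule set_eqI)
    fix i show "i \<in> ?D (x # y # zs) \<longleftrightarrow>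
        i \<in> (if x > y then {0} else {}) \<union> Suc ` ?D (y # zs)"
      by (cases i) auto
  qed
  then show ?case using 1 fin[of "y # zs"]
    by (simp add: card_Un_disjoint card_image card_insert_if)
qed auto

lemma descents_append:
  "descents (xs @ ys) = descents xs + descents ys +
     (if xs \<noteq> [] \<and> ys \<noteq> [] \<and> last xs > hd ys then 1 else 0)"
proof (induction xs rule: descents.induct)
  case ("2_2" x)
  then show ?case by (cases ys) auto
qed auto

lemma no_double_descents_Cons:
  "no_double_descents (x # y # z # zs) \<longleftrightarrow>
     \<not> (x > y \<and> y > z) \<and> no_double_descents (y # z # zs)"
proof -
  let ?w = "x # y # z # zs"
  have "(\<exists>i. P i) \<longleftrightarrow> P 0 \<or> (\<exists>i. P (Suc i))" for P :: "nat \<Rightarrow> bool"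
    by (metis not0_implies_Suc)
  from this[of "\<lambda>i. i + 2 < length ?w \<and> ?w ! i > ?w ! (i + 1) \<and> ?w ! (i + 1) > ?w ! (i + 2)"]
  show ?thesis
    by (simp add: no_double_descents_def)
qed

lemma no_double_descents_short: "length w \<le> 2 \<Longrightarrow> no_double_descents w"
  by (simp add: no_double_descents_def)

text \<open>The new letter exceeds its neighbours, so it can only be the first letter of a double
  descent. Consecutive triples that avoid it lie within \<open>xs\<close> or within
  \<open>ys\<close>.\<close>

lemma no_double_descents_insert_max:
  assumes "\<forall>x\<in>set (xs @ ys). x < m" and "no_double_descents (xs @ ys)"
  shows "no_double_descents (xs @ m # ys) \<longleftrightarrow> \<not> (1 < length ys \<and> ys ! 0 > ys ! 1)"
  using assms
proof (induction xs rule: descents.induct)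
  case (1 x y zs)
  then show ?case
    by (cases zs; cases ys) (auto simp: no_double_descents_Cons no_double_descents_short)
next
  case "2_1"
  then show ?case
    by (cases ys rule: descents.cases)
      (auto simp: no_double_descents_Cons no_double_descents_short)
next
  case ("2_2" x)
  then show ?case
    by (cases ys rule: descents.cases)
      (auto simp: no_double_descents_Cons no_double_descents_short)
qed

section \<open>Simsun permutations in one-line notation\<close>

definition simsun_words :: "nat \<Rightarrow> nat list set" where
  "simsun_words n = {w. distinct w \<and> set w = {1..n} \<and>
     (\<forall>k\<in>{1..n}. no_double_descents (filter (\<lambda>x. x \<le> k) w))}"

lemma simsun_words_length: "w \<in> simsun_words n \<Longrightarrow> length w = n"
  unfolding simsun_words_def using distinct_card by fastforce

lemma finite_simsun_words: "finite (simsun_words n)"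
proof (rule finite_subset)
  show "simsun_words n \<subseteq> {w. set w \<subseteq> {1..n} \<and> length w = n}"
    using simsun_words_length by (auto simp: simsun_words_def)
qed (simp add: finite_lists_length_eq)

text \<open>The condition at k = n concerns the whole word. For n = 0 there is no such k, but then
  the word is empty.\<close>

lemma simsun_words_no_double_descents:
  assumes "w \<in> simsun_words n"
  shows "no_double_descents w"
proof (cases "n = 0")
  case True
  then show ?thesis
    using simsun_words_length[OF assms] by (simp add: no_double_descents_short)
next
  case False
  have "filter (\<lambda>x. x \<le> n) w = w"
    using assms by (auto simp: simsun_words_def filter_id_conv)
  moreover have "no_double_descents (filter (\<lambda>x. x \<le> n) w)"
    using False assms by (auto simp: simsun_words_def dest: bspec[of _ _ n])
  ultimately show ?thesis by simp
qed

lemma des_eq_descents: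
  assumes "n \<ge> 1"
  shows "des n \<pi> = Suc (descents (map \<pi> [1..<n + 1]))"
proof -
  let ?D = "{i. Suc i < n \<and> \<pi> (Suc i) > \<pi> (Suc (Suc i))}"
  have fin: "finite ?D" by (rule finite_subset[of _ "{..n}"]) auto
  \<comment> \<open>The index n always counts, which gives the extra \<open>Suc\<close>; the other
    descents shift by one because list positions start at 0.\<close>
  have "{i \<in> {1..n}. \<pi> i > \<pi> (i + 1) \<or> i = n} = insert n (Suc ` ?D)"
  proof (rule set_eqI)
    fix i show "i \<in> {i \<in> {1..n}. \<pi> i > \<pi> (i + 1) \<or> i = n} \<longleftrightarrow> i \<in> insert n (Suc ` ?D)"
      using assms by (cases i) auto
  qed
  moreover have "n \<notin> Suc ` ?D" by auto
  moreover have "{i. Suc i < length (map \<pi> [1..<n + 1]) \<and>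
      map \<pi> [1..<n + 1] ! i > map \<pi> [1..<n + 1] ! Suc i} = ?D"
    by (auto simp del: upt_Suc)
  ultimately show ?thesis
    using fin by (simp add: des_def descents_conv_card card_image del: upt_Suc)
qed

text \<open>One-line notation loses nothing, since a permutation of \<open>{1..n}\<close> fixes
  every number outside this set. On lists, the largest letter can be inserted and deleted
  directly.\<close>

lemma bij_betw_simsun_words:
  "bij_betw (\<lambda>\<pi>. map \<pi> [1..<n + 1]) {\<pi>. simsun n \<pi>} (simsun_words n)"
proof (rule bij_betw_imageI)
  show "inj_on (\<lambda>\<pi>. map \<pi> [1..<n + 1]) {\<pi>. simsun n \<pi>}"
  proof (rule inj_onI)
    fix \<pi> \<sigma> assume *: "\<pi> \<in> {\<pi>. simsun n \<pi>}" "\<sigma> \<in> {\<pi>. simsun n \<pi>}"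
      "map \<pi> [1..<n + 1] = map \<sigma> [1..<n + 1]"
    show "\<pi> = \<sigma>"
    proof
      fix i show "\<pi> i = \<sigma> i"
      proof (cases "i \<in> {1..n}")
        case True
        then have "i \<in> set [1..<n + 1]" by auto
        then show ?thesis using *(3) unfolding map_eq_conv by blast
      next
        case False
        have "\<pi> permutes {1..n}" "\<sigma> permutes {1..n}" using * by (auto simp: simsun_def)
        with False show ?thesis by (metis permutes_not_in)
      qed
    qed
  qed
  show "(\<lambda>\<pi>. map \<pi> [1..<n + 1]) ` {\<pi>. simsun n \<pi>} = simsun_words n"
  proof (intro equalityI subsetI)
    fix w assume "w \<in> (\<lambda>\<pi>. map \<pi> [1..<n + 1]) ` {\<pi>. simsun n \<pi>}"
    then obtain \<pi> where \<pi>: "simsun n \<pi>" and w: "w = map \<pi> [1..<n + 1]" by auto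
    have p: "\<pi> permutes {1..n}" using \<pi> by (simp add: simsun_def)
    have "set w = \<pi> ` {1..n}" using w by (auto simp del: upt_Suc)
    then have "set w = {1..n}" using p by (simp add: permutes_image)
    moreover have "distinct w"
      using w p by (auto simp: distinct_map permutes_inj_on simp del: upt_Suc)
    ultimately show "w \<in> simsun_words n"
      using \<pi> w by (auto simp: simsun_words_def simsun_def subword_upto_def simp del: upt_Suc)
  next
    fix w assume w: "w \<in> simsun_words n"
    \<comment> \<open>The identity outside \<open>{1..n}\<close> is what \<open>permutes\<close>
      demands; the offset converts positions 1 to n into list positions.\<close>
    define \<pi> where "\<pi> i = (if i \<in> {1..n} then w ! (i - 1) else i)" for i
    have len: "length w = n" using w by (rule simsun_words_length)
    have map: "map \<pi> [1..<n + 1] = w"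
      by (rule nth_equalityI) (auto simp: len \<pi>_def simp del: upt_Suc)
    have "\<pi> ` {1..n} = set (map \<pi> [1..<n + 1])" by (auto simp del: upt_Suc)
    also have "\<dots> = {1..n}" using w unfolding map by (simp add: simsun_words_def)
    finally have "\<pi> ` {1..n} = {1..n}" .
    then have "bij_betw \<pi> {1..n} {1..n}"
      by (simp add: bij_betw_def finite_surj_inj)
    then have "\<pi> permutes {1..n}"
      by (rule bij_imp_permutes) (auto simp: \<pi>_def)
    then have "simsun n \<pi>"
      using w map by (auto simp: simsun_words_def simsun_def subword_upto_def simp del: upt_Suc)
    then show "w \<in> (\<lambda>\<pi>. map \<pi> [1..<n + 1]) ` {\<pi>. simsun n \<pi>}"
      using map by (metis image_eqI mem_Collect_eq)
  qed
qed

section \<open>Insertion of the largest letter\<close>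

definition insert_at :: "nat \<Rightarrow> 'a \<Rightarrow> 'a list \<Rightarrow> 'a list" where
  "insert_at i m w = take i w @ m # drop i w"

text \<open>Inserting or deleting n + 1 does not affect the subwords of letters up to k for k \<le>
  n. So only the condition at k = n + 1, on the whole word, restricts the place of
  insertion.\<close>

lemma simsun_words_Suc:
  "bij_betw (\<lambda>(w, i). insert_at i (Suc n) w)
     (SIGMA w:simsun_words n. {i. i \<le> n \<and> no_double_descents (insert_at i (Suc n) w)})
     (simsun_words (Suc n))"
  (is "bij_betw ?f ?S _")
proof (rule bij_betw_imageI)
  have restr: "filter (\<lambda>x. x \<le> k) (insert_at i (Suc n) w) = filter (\<lambda>x. x \<le> k) w"
    if "k \<le> n" for k i w
  proof -
    have "filter (\<lambda>x. x \<le> k) (insert_at i (Suc n) w) =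
        filter (\<lambda>x. x \<le> k) (take i w @ drop i w)"
      using that by (simp add: insert_at_def del: append_take_drop_id)
    then show ?thesis by simp
  qed
  have id: "filter (\<lambda>x. x \<le> n) w = w" if "w \<in> simsun_words n" for w
    using that by (auto simp: simsun_words_def filter_id_conv)
  show "inj_on ?f ?S"
  proof (rule inj_onI, clarify)
    fix w i w' i'
    assume w: "w \<in> simsun_words n" "w' \<in> simsun_words n" and i: "i \<le> n" "i' \<le> n"
      and eq: "insert_at i (Suc n) w = insert_at i' (Suc n) w'"
    \<comment> \<open>Keeping only the letters up to n undoes both insertions.\<close>
    have ww: "w = w'" using restr[of n i w] restr[of n i' w'] w id eq by simp
    have "Suc n \<notin> set w" using w by (auto simp: simsun_words_def)
    then have "Suc n \<notin> set (take i w)" "Suc n \<notin> set (drop i w)"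
      by (auto dest: in_set_takeD in_set_dropD)
    \<comment> \<open>The place of insertion is recovered as the length of the part before the only
      occurrence of \<open>Suc n\<close>.\<close>
    from append_Cons_eq_iff[OF this] have "take i w = take i' w"
      using eq ww unfolding insert_at_def by blast
    then have "i = i'" using simsun_words_length[OF w(1)] i
      by (metis length_take min.absorb2)
    then show "w = w' \<and> i = i'" using ww by simp
  qed
  show "?f ` ?S = simsun_words (Suc n)"
  proof (intro equalityI subsetI)
    fix u assume "u \<in> ?f ` ?S"
    then obtain w i where w: "w \<in> simsun_words n" "i \<le> n" and nd: "no_double_descents u"
      and u: "u = insert_at i (Suc n) w" by auto
    \<comment> \<open>As multisets, \<open>u\<close> and \<open>Suc n # w\<close> agree, which
      transfers distinctness and the set of letters.\<close>
    have "mset u = mset (take i w @ drop i w) + {#Suc n#}"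
      by (simp add: u insert_at_def del: append_take_drop_id)
    then have ms: "mset u = mset (Suc n # w)" by simp
    have dw: "distinct (Suc n # w)" and sw: "set (Suc n # w) = {1..Suc n}"
      using w by (auto simp: simsun_words_def)
    have du: "distinct u" using ms dw mset_eq_imp_distinct_iff by blast
    have su: "set u = {1..Suc n}" using ms sw mset_eq_setD by blast
    have "no_double_descents (filter (\<lambda>x. x \<le> k) u)" if "k \<in> {1..Suc n}" for k
    proof (cases "k = Suc n")
      case True
      then have "filter (\<lambda>x. x \<le> k) u = u" using su by (auto simp: filter_id_conv)
      then show ?thesis using nd by simp
    next
      case False
      then have "k \<in> {1..n}" using that by auto
      then show ?thesis using restr[of k i w] u w by (auto simp: simsun_words_def)
    qed
    then show "u \<in> simsun_words (Suc n)" using du su by (simp add: simsun_words_def)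
  next
    fix u assume u: "u \<in> simsun_words (Suc n)"
    then have "Suc n \<in> set u" by (simp add: simsun_words_def)
    then obtain xs ys where xy: "u = xs @ Suc n # ys" by (meson split_list)
    define w where "w = xs @ ys"
    have ui: "u = insert_at (length xs) (Suc n) w" by (simp add: xy w_def insert_at_def)
    have "length xs \<le> n" using simsun_words_length[OF u] xy by simp
    have dw: "distinct w" and "set w = set u - {Suc n}"
      using u xy by (auto simp: simsun_words_def w_def)
    then have sw: "set w = {1..n}" using u by (auto simp: simsun_words_def)
    have "no_double_descents (filter (\<lambda>x. x \<le> k) w)" if "k \<in> {1..n}" for k
    proof -
      have "no_double_descents (filter (\<lambda>x. x \<le> k) u)"
        using that u by (simp add: simsun_words_def)
      then show ?thesis using that restr[of k "length xs" w] ui by simp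
    qed
    then have "w \<in> simsun_words n" using sw dw by (simp add: simsun_words_def)
    then show "u \<in> ?f ` ?S"
      using simsun_words_no_double_descents[OF u] ui \<open>length xs \<le> n\<close>
      by (auto intro!: rev_image_eqI[of "(w, length xs)"])
  qed
qed

text \<open>
  Here the recursion can start at n = 0 with value x, whereas the empty permutation contributes 1
  to the polynomial \<^const>\<open>andre_poly\<close>.
\<close>

definition words_poly :: "nat \<Rightarrow> int poly" where
  "words_poly n = (\<Sum>w\<in>simsun_words n. monom 1 (Suc (descents w)))"

lemma andre_poly_eq_words_poly: "n \<ge> 1 \<Longrightarrow> andre_poly n = words_poly n"
  unfolding andre_poly_def words_poly_def
  by (subst sum.reindex_bij_betw[OF bij_betw_simsun_words, symmetric])
    (simp add: des_eq_descents)

lemma words_poly_0: "words_poly 0 = monom 1 1"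
proof -
  have "simsun_words 0 = {[]}" by (auto simp: simsun_words_def)
  then show ?thesis by (simp add: words_poly_def)
qed

lemma sum_monom_const: "(\<Sum>i\<in>A. monom c e) = monom (of_nat (card A) * c) e"
  by (induction A rule: infinite_finite_induct) (simp_all add: add_monom distrib_right)

text \<open>The n + 1 places are sorted into forbidden ones, ones that keep the number of descents
  and ones that raise it by one; their numbers are d, d + 1 and n - 2d for a word with d inner
  descents.\<close>

lemma sum_insert_max:
  assumes less: "\<forall>x\<in>set w. x < m" and len: "length w = n" and nd: "no_double_descents w"
  shows "(\<Sum>i | i \<le> n \<and> no_double_descents (insert_at i m w).
      monom 1 (Suc (descents (insert_at i m w)))) = andre_step n (monom 1 (Suc (descents w)))"
proof -
  \<comment> \<open>For \<open>i\<close> in \<open>D\<close>, place \<open>i\<close> is right before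
    a descent top and place \<open>Suc i\<close> is inside that descent; place \<open>n\<close> is
    the end of the word. Thus \<open>D\<close> is forbidden, and \<open>K\<close> will keep the
    number of descents.\<close>
  define D where "D = {i. Suc i < n \<and> w ! i > w ! Suc i}"
  define K where "K = insert n (Suc ` D)"
  define I where "I = {i. i \<le> n \<and> no_double_descents (insert_at i m w)}"
  let ?d = "descents w"
  have fin: "finite D" by (rule finite_subset[of _ "{..n}"]) (auto simp: D_def)
  have cD: "card D = ?d" by (simp add: D_def descents_conv_card len)
  have "no_double_descents (insert_at i m w) \<longleftrightarrow> i \<notin> D" if "i \<le> n" for i
    using no_double_descents_insert_max[of "take i w" "drop i w" m] less nd that
    by (auto simp: insert_at_def D_def len)
  then have I: "I = {..n} - D" by (auto simp: I_def)
  have "D \<subseteq> {..n}" by (auto simp: D_def)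
  then have "card I + ?d = Suc n"
    using I fin cD card_mono[of "{..n}" D] by (simp add: card_Diff_subset)
  moreover have finI: "finite I" by (simp add: I)
  moreover have cK: "card K = Suc ?d"
    using fin cD by (auto simp: K_def D_def card_insert_if card_image)
  \<comment> \<open>If \<open>i\<close> and \<open>Suc i\<close> were both in \<open>D\<close>, then
    \<open>w\<close> would have a double descent at \<open>i\<close>.\<close>
  moreover have KI: "K \<subseteq> I"
    using nd by (auto simp: K_def I D_def no_double_descents_def len)
  ultimately have cIK: "int (card (I - K)) = int n - 2 * int ?d"
    using card_mono[OF finI KI] by (simp add: card_Diff_subset finite_subset of_nat_diff)
  have ins: "descents (insert_at i m w) = (if i \<in> K then ?d else Suc ?d)" if i: "i \<le> n" for i
  proof -
    have last_take: "last (take i w) = w ! (i - 1)" if "0 < i" "0 < n"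
      using that i len by (subst last_conv_nth) (auto simp: min_def)
    \<comment> \<open>Cutting \<open>w\<close> at place \<open>i\<close> loses a descent exactly
      when the cut falls inside one.\<close>
    have "descents w = descents (take i w @ drop i w)" by simp
    also have "\<dots> = descents (take i w) + descents (drop i w) +
        (if 0 < i \<and> i < n \<and> w ! (i - 1) > w ! i then 1 else 0)"
      unfolding descents_append using that len
      using last_take by (auto simp: hd_drop_conv_nth)
    finally have w: "descents w = descents (take i w) + descents (drop i w) +
        (if i \<in> Suc ` D then 1 else 0)"
      using that by (cases i) (auto simp: D_def)
    \<comment> \<open>The letter \<open>m\<close> makes no descent with its left neighbour, and
      makes one with its right neighbour whenever there is one.\<close>
    have "\<not> last (take i w) > m" if "take i w \<noteq> []"
      using less last_in_set[OF that] in_set_takeD[of "last (take i w)" i w] by fastforce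
    moreover have "descents (m # drop i w) = descents (drop i w) + (if i < n then 1 else 0)"
    proof (cases "drop i w")
      case Nil
      then show ?thesis using len by simp
    next
      case (Cons x xs)
      then have "x \<in> set w" by (metis in_set_dropD list.set_intros(1))
      then show ?thesis using less Cons len
        by (metis descents.simps(1) add.commute drop_all list.distinct(1) not_less)
    qed
    ultimately have "descents (insert_at i m w) =
        descents (take i w) + descents (drop i w) + (if i < n then 1 else 0)"
      unfolding insert_at_def descents_append by auto
    \<comment> \<open>Inside a descent the new descent replaces the lost one; at the end nothing is
      lost or gained; elsewhere one is gained.\<close>
    with w show ?thesis using that by (auto simp: K_def D_def)
  qed
  have "(\<Sum>i\<in>I. monom (1::int) (Suc (descents (insert_at i m w)))) =
      (\<Sum>i\<in>K. monom 1 (Suc (descents (insert_at i m w)))) +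
      (\<Sum>i\<in>I - K. monom 1 (Suc (descents (insert_at i m w))))"
    using sum.subset_diff[OF KI finI] by (simp add: add.commute)
  also have "\<dots> = (\<Sum>i\<in>K. monom 1 (Suc ?d)) + (\<Sum>i\<in>I - K. monom 1 (Suc (Suc ?d)))"
    using KI by (intro arg_cong2[of _ _ _ _ "(+)"] sum.cong) (auto simp: ins I)
  also have "\<dots> = andre_step n (monom 1 (Suc ?d))"
    by (simp add: sum_monom_const andre_step_monom cK cIK add.commute
        del: sum_constant)
  finally show ?thesis by (simp add: I_def)
qed

text \<open>The words on n + 1 letters are grouped by what remains after deleting the letter n +
  1.\<close>

lemma words_poly_Suc: "words_poly (Suc n) = andre_step n (words_poly n)"
proof -
  let ?I = "\<lambda>w. {i. i \<le> n \<and> no_double_descents (insert_at i (Suc n) w)}"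
  have "words_poly (Suc n) = (\<Sum>(w, i)\<in>Sigma (simsun_words n) ?I.
      monom 1 (Suc (descents (insert_at i (Suc n) w))))"
    unfolding words_poly_def
    by (subst sum.reindex_bij_betw[OF simsun_words_Suc, symmetric]) (simp add: case_prod_beta)
  also have "\<dots> = (\<Sum>w\<in>simsun_words n. \<Sum>i\<in>?I w.
      monom 1 (Suc (descents (insert_at i (Suc n) w))))"
    by (rule sum.Sigma[symmetric]) (auto simp: finite_simsun_words)
  also have "\<dots> = (\<Sum>w\<in>simsun_words n. andre_step n (monom 1 (Suc (descents w))))"
  proof (rule sum.cong[OF refl])
    fix w assume w: "w \<in> simsun_words n"
    show "(\<Sum>i\<in>?I w. monom 1 (Suc (descents (insert_at i (Suc n) w)))) =
        andre_step n (monom 1 (Suc (descents w)))"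
      using w simsun_words_length[OF w] simsun_words_no_double_descents[OF w]
      by (intro sum_insert_max) (auto simp: simsun_words_def)
  qed
  finally show ?thesis by (simp add: words_poly_def andre_step_sum)
qed

section \<open>Two-column tableaux\<close>

text \<open>Assembles rows from a first column and a second column, both read from bottom to top.
  Entries of the second column beyond the height of the first are dropped, hence the recurring bound
  \<open>length d \<le> length c\<close>.\<close>

fun tableau_of :: "nat list \<Rightarrow> nat list \<Rightarrow> tableau" where
  "tableau_of [] d = []"
| "tableau_of (x # c) [] = [x] # tableau_of c []"
| "tableau_of (x # c) (y # d) = [x, y] # tableau_of c d"

lemma length_tableau_of [simp]: "length (tableau_of c d) = length c"
  by (induction c d rule: tableau_of.induct) auto

lemma nth_tableau_of:
  "i < length c \<Longrightarrow> tableau_of c d ! i = (if i < length d then [c ! i, d ! i] else [c ! i])"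
  by (induction c d arbitrary: i rule: tableau_of.induct) (auto simp: less_Suc_eq_0_disj)

text \<open>The length of each row tells whether the second column reaches it, and the bounds leave
  no entries of that column above the last row.\<close>

lemma tableau_of_inject:
  assumes "length d \<le> length c" "length d' \<le> length c'" "tableau_of c d = tableau_of c' d'"
  shows "c = c' \<and> d = d'"
  using assms
proof (induction c d arbitrary: c' d' rule: tableau_of.induct)
  case (1 d)
  then show ?case by (cases c'; cases d') auto
next
  case (2 x c)
  obtain x' e where c': "c' = x' # e" using 2 by (cases c') auto
  then have d': "d' = []" using 2 by (cases d') auto
  have eq: "x = x'" "tableau_of c [] = tableau_of e d'" using 2(4) c' d' by simp_all
  from 2(1)[OF _ _ eq(2)] show ?case using eq(1) c' d' by simp
next
  case (3 x c y d)
  obtain x' e where c': "c' = x' # e" using 3 by (cases c') auto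
  then obtain y' f where d': "d' = y' # f" using 3 by (cases d') auto
  have eq: "x = x'" "y = y'" "tableau_of c d = tableau_of e f" using 3(4) c' d' by simp_all
  have "length d \<le> length c" "length f \<le> length e" using 3 c' d' by simp_all
  from 3(1)[OF this eq(3)] show ?case using eq c' d' by simp
qed

lemma shape_tableau_of:
  "length d \<le> length c \<Longrightarrow>
     shape (tableau_of c d) = replicate (length d) 2 @ replicate (length c - length d) 1"
  by (induction c d rule: tableau_of.induct) (auto simp: shape_def)

lemma boxes_tableau_of:
  "length d \<le> length c \<Longrightarrow>
     boxes (tableau_of c d) = {1..length c} \<times> {1} \<union> {1..length d} \<times> {2}"
  by (auto simp: boxes_def nth_tableau_of split: if_splits)

lemma entry_tableau_of:
  "i < length c \<Longrightarrow> entry (tableau_of c d) (Suc i, Suc 0) = c ! i"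
  "length d \<le> length c \<Longrightarrow> i < length d \<Longrightarrow> entry (tableau_of c d) (Suc i, 2) = d ! i"
  by (auto simp: entry_def nth_tableau_of)

text \<open>Row lengths weakly decrease upwards, so the rows of length two come first and their
  second entries form one column without gaps.\<close>

lemma two_columns_tableau_of:
  assumes "sorted_wrt (\<ge>) (shape T)" "0 \<notin> set (shape T)" "at_most_two_columns T"
  shows "\<exists>c d. length d \<le> length c \<and> T = tableau_of c d"
  using assms
proof (induction T)
  case Nil
  then show ?case by (intro exI[of _ "[]"]) simp
next
  case (Cons row T)
  then obtain c d where cd: "length d \<le> length c" "T = tableau_of c d"
    by (auto simp: shape_def at_most_two_columns_def)
  from Cons.prems have "row \<noteq> []" "length row \<le> 2"
    by (auto simp: shape_def at_most_two_columns_def)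
  then consider x where "row = [x]" | x y where "row = [x, y]"
    by (cases row rule: descents.cases) auto
  then show ?case
  proof cases
    case 1
    \<comment> \<open>Otherwise a row of length two would stand above a row of length one.\<close>
    have "d = []"
    proof (rule ccontr)
      assume "d \<noteq> []"
      then obtain x' c' y' d' where "c = x' # c'" "d = y' # d'"
        using cd(1) by (cases c; cases d) auto
      then show False using Cons.prems(1) cd(2) 1 by (simp add: shape_def)
    qed
    then show ?thesis using cd 1 by (intro exI[of _ "x # c"] exI[of _ "[]"]) simp
  next
    case 2
    then show ?thesis using cd by (intro exI[of _ "x # c"] exI[of _ "y # d"]) simp
  qed
qed

section \<open>Standard tableaux as pairs of increasing columns\<close>

definition column_pairs :: "nat \<Rightarrow> (nat list \<times> nat list) set" where
  "column_pairs n = {(c, d). length d \<le> length c \<and> sorted_wrt (<) c \<and> sorted_wrt (<) d \<and>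
     (\<forall>i<length d. c ! i < d ! i) \<and> set c \<inter> set d = {} \<and> set c \<union> set d = {1..n}}"

lemma column_pairs_length:
  assumes "(c, d) \<in> column_pairs n"
  shows "length c + length d = n"
proof -
  have "card (set c \<union> set d) = length c + length d"
    using assms by (subst card_Un_disjoint)
      (auto simp: column_pairs_def strict_sorted_iff distinct_card)
  then show ?thesis using assms by (simp add: column_pairs_def)
qed

lemma entry_image_tableau_of:
  assumes "length d \<le> length c"
  shows "entry (tableau_of c d) ` boxes (tableau_of c d) = set c \<union> set d"
proof -
  have 1: "{1..k} \<times> {j} = (\<lambda>i. (Suc i, j)) ` {..<k}" for k j :: nat
    unfolding One_nat_def[symmetric] image_Suc_lessThan[symmetric] by auto
  show ?thesis
    unfolding boxes_tableau_of[OF assms] image_Un 1 image_image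
    using assms by (auto simp: entry_tableau_of set_conv_nth image_iff)
qed

text \<open>Increasing columns have distinct entries, so bijectivity of the filling reduces to the
  two columns being disjoint with union \<open>{1..n}\<close>. The row condition compares entries at
  equal list positions.\<close>

lemma tableau_of_in_SYT_iff:
  assumes le: "length d \<le> length c"
  shows "tableau_of c d \<in> SYT n \<longleftrightarrow> (c, d) \<in> column_pairs n"
proof
  let ?T = "tableau_of c d"
  assume T: "?T \<in> SYT n"
  then have bij: "bij_betw (entry ?T) (boxes ?T) {1..n}"
    and row: "\<And>r c c'. (r, c) \<in> boxes ?T \<Longrightarrow> (r, c') \<in> boxes ?T \<Longrightarrow> c < c' \<Longrightarrow>
        entry ?T (r, c) < entry ?T (r, c')"
    and col: "\<And>r r' c. (r, c) \<in> boxes ?T \<Longrightarrow> (r', c) \<in> boxes ?T \<Longrightarrow> r < r' \<Longrightarrow>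
        entry ?T (r, c) < entry ?T (r', c)"
    by (auto simp: SYT_def)
  have inj: "inj_on (entry ?T) (boxes ?T)" and img: "set c \<union> set d = {1..n}"
    using bij entry_image_tableau_of[OF le] by (auto simp: bij_betw_def)
  have "sorted_wrt (<) c"
    unfolding sorted_wrt_iff_nth_less
  proof (intro allI impI)
    fix i j assume "i < j" "j < length c"
    then show "c ! i < c ! j"
      using col[of "Suc i" 1 "Suc j"] le by (simp add: boxes_tableau_of entry_tableau_of)
  qed
  moreover have "sorted_wrt (<) d"
    unfolding sorted_wrt_iff_nth_less
  proof (intro allI impI)
    fix i j assume "i < j" "j < length d"
    then show "d ! i < d ! j"
      using col[of "Suc i" 2 "Suc j"] le by (simp add: boxes_tableau_of entry_tableau_of)
  qed
  moreover have "c ! i < d ! i" if "i < length d" for i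
    using row[of "Suc i" 1 2] le that by (simp add: boxes_tableau_of entry_tableau_of)
  moreover have "c ! i \<noteq> d ! j" if "i < length c" "j < length d" for i j
    using inj_onD[OF inj, of "(Suc i, 1)" "(Suc j, 2)"] le that
    by (auto simp: boxes_tableau_of entry_tableau_of)
  then have "set c \<inter> set d = {}"
    by (auto simp: set_conv_nth)
  ultimately show "(c, d) \<in> column_pairs n" using le img by (simp add: column_pairs_def)
next
  let ?T = "tableau_of c d"
  assume cd: "(c, d) \<in> column_pairs n"
  then have c: "\<And>i j. i < j \<Longrightarrow> j < length c \<Longrightarrow> c ! i < c ! j"
    and d: "\<And>i j. i < j \<Longrightarrow> j < length d \<Longrightarrow> d ! i < d ! j"
    and r: "\<And>i. i < length d \<Longrightarrow> c ! i < d ! i"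
    and disj: "set c \<inter> set d = {}" and img: "set c \<union> set d = {1..n}"
    by (auto simp: column_pairs_def sorted_wrt_iff_nth_less)
  have box: "(r, k) \<in> boxes ?T \<longleftrightarrow> (\<exists>i. r = Suc i \<and> (k = 1 \<and> i < length c \<or> k = 2 \<and> i < length d))"
    for r k
    unfolding boxes_tableau_of[OF le] by (cases r) auto
  note ent = entry_tableau_of(1) entry_tableau_of(2)[OF le]
  have "is_partition n (shape ?T)"
    using le column_pairs_length[OF cd]
    by (auto simp: is_partition_def shape_tableau_of sorted_wrt_iff_nth_less
        sum_list_replicate nth_append)
  moreover have "entry ?T ` boxes ?T = {1..n}"
    using entry_image_tableau_of[OF le] img by simp
  moreover have "inj_on (entry ?T) (boxes ?T)"
  proof (rule inj_onI, clarify)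
    fix r k r' k' assume *: "(r, k) \<in> boxes ?T" "(r', k') \<in> boxes ?T"
      "entry ?T (r, k) = entry ?T (r', k')"
    have "distinct c" "distinct d" using cd by (auto simp: column_pairs_def strict_sorted_iff)
    moreover have "c ! i \<noteq> d ! j" "d ! j \<noteq> c ! i" if "i < length c" "j < length d" for i j
      using disj that by (metis disjoint_iff nth_mem)+
    ultimately show "r = r' \<and> k = k'"
      using * unfolding box by (elim exE conjE disjE) (simp_all add: ent nth_eq_iff_index_eq)
  qed
  moreover have "entry ?T (r, k) < entry ?T (r, k')"
    if "(r, k) \<in> boxes ?T" "(r, k') \<in> boxes ?T" "k < k'" for r k k'
    using that r unfolding box by (auto simp: ent)
  moreover have "entry ?T (r, k) < entry ?T (r', k)"
    if "(r, k) \<in> boxes ?T" "(r', k) \<in> boxes ?T" "r < r'" for r r' k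
    using that c d unfolding box by (auto simp: ent)
  ultimately show "?T \<in> SYT n" by (simp add: SYT_def bij_betw_def)
qed

lemma bij_betw_tableau_of:
  "bij_betw (\<lambda>(c, d). tableau_of c d) (column_pairs n) {T. T \<in> SYT n \<and> at_most_two_columns T}"
proof (rule bij_betw_imageI)
  show "inj_on (\<lambda>(c, d). tableau_of c d) (column_pairs n)"
    using tableau_of_inject by (fastforce simp: inj_on_def column_pairs_def)
  have two: "at_most_two_columns (tableau_of c d)" for c d
    by (induction c d rule: tableau_of.induct) (auto simp: at_most_two_columns_def)
  show "(\<lambda>(c, d). tableau_of c d) ` column_pairs n = {T. T \<in> SYT n \<and> at_most_two_columns T}"
  proof (intro equalityI subsetI)
    fix T assume "T \<in> (\<lambda>(c, d). tableau_of c d) ` column_pairs n"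
    then obtain c d where cd: "(c, d) \<in> column_pairs n" "T = tableau_of c d" by auto
    then have "length d \<le> length c" by (simp add: column_pairs_def)
    then show "T \<in> {T. T \<in> SYT n \<and> at_most_two_columns T}"
      using cd two by (simp add: tableau_of_in_SYT_iff)
  next
    fix T assume T: "T \<in> {T. T \<in> SYT n \<and> at_most_two_columns T}"
    then obtain c d where cd: "length d \<le> length c" "T = tableau_of c d"
      using two_columns_tableau_of[of T] by (auto simp: SYT_def is_partition_def)
    then have "(c, d) \<in> column_pairs n" using T tableau_of_in_SYT_iff by blast
    then show "T \<in> (\<lambda>(c, d). tableau_of c d) ` column_pairs n"
      using cd by (auto intro!: rev_image_eqI)
  qed
qed

section \<open>The factors of the g-index for two columns\<close>

lemma box_of_entry:
  assumes "T \<in> SYT n" "b \<in> boxes T"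
  shows "box_of T (entry T b) = b"
proof -
  have "inj_on (entry T) (boxes T)"
    using assms by (simp add: SYT_def bij_betw_def)
  then show ?thesis
    using assms(2) unfolding box_of_def by (intro the_equality) (auto dest: inj_onD)
qed

text \<open>Labels in column 0 equal their row numbers, so the rows counted run from
  \<open>Suc i\<close> to \<open>c ! i\<close>; all of them exist because
  \<open>c ! i \<le> n\<close>.\<close>

lemma g_value_first_column:
  assumes cd: "(c, d) \<in> column_pairs n" and i: "i < length c"
  shows "g_value n (tableau_of c d) (c ! i) = c ! i - i"
proof -
  let ?T = "tableau_of c d"
  have le: "length d \<le> length c" using cd by (simp add: column_pairs_def)
  have T: "?T \<in> SYT n" using cd le tableau_of_in_SYT_iff by blast
  have "box_of ?T (c ! i) = (Suc i, 1)"
    using box_of_entry[OF T, of "(Suc i, 1)"] i le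
    by (simp add: boxes_tableau_of entry_tableau_of)
  moreover have "c ! i \<le> n"
    using cd nth_mem[OF i] by (force simp: column_pairs_def)
  then have "{j. j \<ge> Suc i \<and> (j, 0) \<in> ext_boxes n ?T \<and> ext_entry ?T (j, 0) \<le> c ! i} =
      {Suc i..c ! i}"
    by (auto simp: ext_boxes_def ext_entry_def boxes_tableau_of[OF le])
  ultimately show ?thesis by (simp add: g_value_def)
qed

text \<open>After the shift to list positions the count involves only first-column entries up to
  \<open>d ! i\<close>, so it is insensitive to larger entries added later.\<close>

lemma g_value_second_column:
  assumes cd: "(c, d) \<in> column_pairs n" and i: "i < length d"
  shows "g_value n (tableau_of c d) (d ! i) = card {j. i \<le> j \<and> j < length c \<and> c ! j \<le> d ! i}"
proof -
  let ?T = "tableau_of c d"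
  have le: "length d \<le> length c" using cd by (simp add: column_pairs_def)
  have T: "?T \<in> SYT n" using cd le tableau_of_in_SYT_iff by blast
  have "box_of ?T (d ! i) = (Suc i, 2)"
    using box_of_entry[OF T, of "(Suc i, 2)"] i le
    by (simp add: boxes_tableau_of entry_tableau_of)
  moreover have "{j. j \<ge> Suc i \<and> (j, Suc 0) \<in> ext_boxes n ?T \<and> ext_entry ?T (j, Suc 0) \<le> d ! i} =
      Suc ` {j. i \<le> j \<and> j < length c \<and> c ! j \<le> d ! i}" (is "?A = ?B")
  proof (rule set_eqI)
    fix j show "j \<in> ?A \<longleftrightarrow> j \<in> ?B"
      using le i by (cases j)
        (auto simp: ext_boxes_def ext_entry_def boxes_tableau_of entry_tableau_of)
  qed
  ultimately show ?thesis by (simp add: g_value_def card_image)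
qed

section \<open>Growing a tableau by its largest entry\<close>

lemma column_pairs_snoc_first:
  assumes "(c, d) \<in> column_pairs n"
  shows "(c @ [Suc n], d) \<in> column_pairs (Suc n)"
proof -
  have "set c \<union> set d = {1..n}" using assms by (simp add: column_pairs_def)
  then have "\<forall>x\<in>set c \<union> set d. x \<le> n" by auto
  then show ?thesis
    using assms
    by (auto simp: column_pairs_def sorted_wrt_append nth_append less_Suc_eq_le
        atLeastAtMostSuc_conv)
qed

lemma column_pairs_snoc_second:
  assumes "(c, d) \<in> column_pairs n" "length d < length c"
  shows "(c, d @ [Suc n]) \<in> column_pairs (Suc n)"
proof -
  have "set c \<union> set d = {1..n}" using assms by (simp add: column_pairs_def)
  then have *: "\<forall>x\<in>set c \<union> set d. x \<le> n" by auto
  \<comment> \<open>This entry is the left neighbour of the new box; it exists because the second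
    column is strictly shorter.\<close>
  moreover have "c ! length d \<le> n" using * assms(2) by auto
  moreover have "Suc n \<notin> set c" using * by (metis UnI1 Suc_n_not_le_n)
  moreover have "c ! i < (d @ [Suc n]) ! i" if "i < Suc (length d)" for i
    using that assms \<open>c ! length d \<le> n\<close>
    by (cases "i = length d") (auto simp: column_pairs_def nth_append)
  ultimately show ?thesis
    using assms
    by (auto simp: column_pairs_def sorted_wrt_append less_Suc_eq_le atLeastAtMostSuc_conv)
qed

lemma column_pairs_cases:
  assumes "(c, d) \<in> column_pairs n" "v \<in> {1..n}"
  obtains i where "i < length c" "v = c ! i" | i where "i < length d" "v = d ! i"
proof -
  have "v \<in> set c \<union> set d" using assms by (simp add: column_pairs_def)
  then show ?thesis using that by (auto simp: in_set_conv_nth)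
qed

lemma column_pairs_le:
  assumes "(c, d) \<in> column_pairs n" "v \<in> set c \<union> set d"
  shows "v \<le> n"
  using assms by (auto simp: column_pairs_def)

text \<open>Earlier factors count only entries up to v \<le> n and do not change. The new factor is
  n + 1 minus the old height of the first column, that is, one more than the height of the
  second.\<close>

lemma g_index_snoc_first:
  assumes cd: "(c, d) \<in> column_pairs n"
  shows "g_index (Suc n) (tableau_of (c @ [Suc n]) d) =
     g_index n (tableau_of c d) * Suc (length d)"
proof -
  let ?c = "c @ [Suc n]"
  note cd' = column_pairs_snoc_first[OF cd]
  have "g_value (Suc n) (tableau_of ?c d) v = g_value n (tableau_of c d) v"
    if "v \<in> {1..n}" for v
    using cd that
  proof (cases rule: column_pairs_cases)
    case (1 i)
    then show ?thesis
      using g_value_first_column[OF cd, of i] g_value_first_column[OF cd', of i]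
      by (simp add: nth_append)
  next
    case (2 i)
    have "{j. i \<le> j \<and> j < length ?c \<and> ?c ! j \<le> v} = {j. i \<le> j \<and> j < length c \<and> c ! j \<le> v}"
      using that by (auto simp: nth_append split: if_splits)
    then show ?thesis
      using 2 g_value_second_column[OF cd, of i] g_value_second_column[OF cd', of i] by simp
  qed
  moreover have "g_value (Suc n) (tableau_of ?c d) (Suc n) = Suc (length d)"
    using g_value_first_column[OF cd', of "length c"] column_pairs_length[OF cd] by simp
  ultimately show ?thesis by (simp add: g_index_def)
qed

text \<open>Earlier factors are unchanged. For the new entry every first-column entry is small
  enough, so all rows from the new box upwards are counted.\<close>

lemma g_index_snoc_second:
  assumes cd: "(c, d) \<in> column_pairs n" and less: "length d < length c"
  shows "g_index (Suc n) (tableau_of c (d @ [Suc n])) =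
     g_index n (tableau_of c d) * (length c - length d)"
proof -
  let ?d = "d @ [Suc n]"
  note cd' = column_pairs_snoc_second[OF cd less]
  have "g_value (Suc n) (tableau_of c ?d) v = g_value n (tableau_of c d) v"
    if "v \<in> {1..n}" for v
    using cd that
  proof (cases rule: column_pairs_cases)
    case (1 i)
    then show ?thesis
      using g_value_first_column[OF cd, of i] g_value_first_column[OF cd', of i] by simp
  next
    case (2 i)
    then show ?thesis
      using g_value_second_column[OF cd, of i] g_value_second_column[OF cd', of i]
      by (simp add: nth_append)
  qed
  moreover have "{j. length d \<le> j \<and> j < length c \<and> c ! j \<le> Suc n} = {length d..<length c}"
    using column_pairs_le[OF cd] by (auto intro: le_SucI)
  then have "g_value (Suc n) (tableau_of c ?d) (Suc n) = length c - length d"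
    using g_value_second_column[OF cd', of "length d"] by simp
  ultimately show ?thesis by (simp add: g_index_def)
qed

lemma sorted_wrt_less_snoc:
  fixes xs :: "nat list"
  assumes "sorted_wrt (<) xs" "m \<in> set xs" "\<forall>x\<in>set xs. x \<le> m"
  obtains ys where "xs = ys @ [m]"
proof -
  obtain ys zs where "xs = ys @ m # zs" using assms(2) by (meson split_list)
  then show ?thesis using assms that by (cases zs) (auto simp: sorted_wrt_append)
qed

text \<open>The largest entry is at the top of its column, and removing it leaves a pair for
  n.\<close>

lemma column_pairs_Suc:
  "column_pairs (Suc n) = (\<lambda>(c, d). (c @ [Suc n], d)) ` column_pairs n \<union>
     (\<lambda>(c, d). (c, d @ [Suc n])) ` {(c, d) \<in> column_pairs n. length d < length c}"
  (is "_ = ?A \<union> ?B")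
proof (intro equalityI subsetI)
  fix p assume "p \<in> ?A \<union> ?B"
  then show "p \<in> column_pairs (Suc n)"
    using column_pairs_snoc_first column_pairs_snoc_second by auto
next
  fix p assume p: "p \<in> column_pairs (Suc n)"
  obtain c d where p_eq: "p = (c, d)" by (cases p)
  have cd: "length d \<le> length c" "sorted_wrt (<) c" "sorted_wrt (<) d"
    "\<forall>i<length d. c ! i < d ! i" "set c \<inter> set d = {}" "set c \<union> set d = {1..Suc n}"
    using p by (auto simp: p_eq column_pairs_def)
  have le: "\<forall>x\<in>set c. x \<le> Suc n" "\<forall>x\<in>set d. x \<le> Suc n"
    using cd(6) by auto
  have Suc_diff: "{1..n} = {1..Suc n} - {Suc n}" by auto
  have "Suc n \<in> set c \<or> Suc n \<in> set d" using cd(6) by auto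
  then show "p \<in> ?A \<union> ?B"
  proof
    assume "Suc n \<in> set c"
    then obtain e where e: "c = e @ [Suc n]"
      using sorted_wrt_less_snoc cd(2) le(1) by blast
    \<comment> \<open>With columns of equal height, the right neighbour of \<open>Suc n\<close>
      would be larger still. Hence shortening the first column keeps it at least as long as the
      second.\<close>
    have "length d \<noteq> length c"
    proof
      assume len: "length d = length c"
      then have "Suc n < d ! length e"
        using cd(4) e by (metis length_append_singleton lessI nth_append_length)
      moreover have "d ! length e \<in> set d" using len e by simp
      ultimately show False using le(2) by auto
    qed
    moreover have "Suc n \<notin> set e" "Suc n \<notin> set d" using cd(2,5) e by (auto simp: sorted_wrt_append)
    then have "set e \<union> set d = {1..n}"
      unfolding Suc_diff cd(6)[symmetric] using e by auto
    moreover have "\<forall>i<length d. e ! i < d ! i" if "length d \<le> length e"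
      using cd(4) that by (auto simp: e nth_append)
    ultimately have "(e, d) \<in> column_pairs n"
      using cd e by (auto simp: column_pairs_def sorted_wrt_append)
    then show ?thesis using e p_eq by (auto intro: rev_image_eqI)
  next
    assume "Suc n \<in> set d"
    then obtain e where e: "d = e @ [Suc n]"
      using sorted_wrt_less_snoc cd(3) le(2) by blast
    have "Suc n \<notin> set e" "Suc n \<notin> set c" using cd(3,5) e by (auto simp: sorted_wrt_append)
    then have "set c \<union> set e = {1..n}"
      unfolding Suc_diff cd(6)[symmetric] using e by auto
    moreover have "\<forall>i<length e. c ! i < e ! i"
    proof (intro allI impI)
      fix i assume "i < length e"
      then show "c ! i < e ! i" using cd(4)[rule_format, of i] by (simp add: e nth_append)
    qed
    moreover have "length e \<le> length c" "sorted_wrt (<) e" "set c \<inter> set e = {}"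
      using cd(1,3,5) by (auto simp: e sorted_wrt_append)
    ultimately have "(c, e) \<in> column_pairs n"
      using cd(2) by (simp add: column_pairs_def)
    then show ?thesis using e p_eq cd(1) by (auto intro: rev_image_eqI)
  qed
qed

section \<open>The polynomial of two-column tableaux\<close>

definition tableaux_poly :: "nat \<Rightarrow> int poly" where
  "tableaux_poly n = (\<Sum>(c, d)\<in>column_pairs n.
     monom (int (g_index n (tableau_of c d))) (Suc (length d)))"

text \<open>The number of rows is the height of the first column, and the two heights add up to n,
  so the exponent is one more than the height of the second.\<close>

lemma tableaux_poly_eq_sum_SYT:
  "tableaux_poly n = (\<Sum>T | T \<in> SYT n \<and> at_most_two_columns T.
     monom (int (g_index n T)) (n + 1 - length (shape T)))"
  unfolding tableaux_poly_def sum.reindex_bij_betw[OF bij_betw_tableau_of, symmetric]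
proof (rule sum.cong[OF refl])
  fix p assume p: "p \<in> column_pairs n"
  obtain c d where cd: "p = (c, d)" by (cases p)
  show "(case p of (c, d) \<Rightarrow> monom (int (g_index n (tableau_of c d))) (Suc (length d))) =
      monom (int (g_index n (case p of (c, d) \<Rightarrow> tableau_of c d)))
        (n + 1 - length (shape (case p of (c, d) \<Rightarrow> tableau_of c d)))"
    using column_pairs_length[of c d n] p by (auto simp: cd shape_def)
qed

lemma column_pairs_0: "column_pairs 0 = {([], [])}"
  by (auto simp: column_pairs_def)

lemma tableaux_poly_0: "tableaux_poly 0 = monom 1 1"
  by (simp add: tableaux_poly_def column_pairs_0 g_index_def)

lemma finite_column_pairs: "finite (column_pairs n)"
proof (induction n)
  case 0
  then show ?case by (simp add: column_pairs_0)
next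
  case (Suc n)
  moreover have "finite {(c, d) \<in> column_pairs n. length d < length c}"
    by (rule finite_subset[OF _ Suc]) auto
  ultimately show ?case by (simp add: column_pairs_Suc)
qed

text \<open>The sum splits according to the column that holds n + 1.\<close>

lemma tableaux_poly_Suc: "tableaux_poly (Suc n) = andre_step n (tableaux_poly n)"
proof -
  let ?P = "column_pairs n"
  let ?Q = "{(c, d) \<in> ?P. length d < length c}"
  let ?f = "\<lambda>(c, d). (c @ [Suc n], d)" and ?g = "\<lambda>(c, d). (c, d @ [Suc n])"
  let ?t = "\<lambda>(c, d). monom (int (g_index (Suc n) (tableau_of c d))) (Suc (length d))"
  let ?G = "\<lambda>c d. int (g_index n (tableau_of c d))"
  have fin: "finite ?Q" by (rule finite_subset[OF _ finite_column_pairs[of n]]) auto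
  have disj: "?f ` ?P \<inter> ?g ` ?Q = {}"
  proof -
    \<comment> \<open>Equality would put \<open>Suc n\<close> into \<open>c'\<close>, whose entries
      are at most \<open>n\<close>.\<close>
    have "(c @ [Suc n], d) \<noteq> (c', d' @ [Suc n])" if "(c', d') \<in> ?P" for c d c' d'
      using column_pairs_le[OF that, of "Suc n"] by auto
    then show ?thesis by (auto simp: image_iff)
  qed
  have "tableaux_poly (Suc n) = sum ?t (?f ` ?P) + sum ?t (?g ` ?Q)"
    unfolding tableaux_poly_def column_pairs_Suc
    using disj fin finite_column_pairs by (intro sum.union_disjoint) auto
  also have "sum ?t (?f ` ?P) =
      (\<Sum>(c, d)\<in>?P. monom (?G c d * (int (length d) + 1)) (Suc (length d)))"
    by (subst sum.reindex)
      (auto simp: inj_on_def g_index_snoc_first algebra_simps intro!: sum.cong)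
  also have "sum ?t (?g ` ?Q) =
      (\<Sum>(c, d)\<in>?Q. monom (?G c d * (int (length c) - int (length d))) (Suc (Suc (length d))))"
    by (subst sum.reindex)
      (auto simp: inj_on_def g_index_snoc_second of_nat_diff intro!: sum.cong)
  \<comment> \<open>Pairs with columns of equal height have coefficient 0, so the sum may run over
    all pairs.\<close>
  also have "\<dots> =
      (\<Sum>(c, d)\<in>?P. monom (?G c d * (int (length c) - int (length d))) (Suc (Suc (length d))))"
    by (rule sum.mono_neutral_left[OF finite_column_pairs]) (auto simp: column_pairs_def)
  also have "(\<Sum>(c, d)\<in>?P. monom (?G c d * (int (length d) + 1)) (Suc (length d))) + \<dots> =
      (\<Sum>(c, d)\<in>?P. andre_step n (monom (?G c d) (Suc (length d))))"
    unfolding sum.distrib[symmetric]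
  proof (rule sum.cong[OF refl], clarify)
    fix c d assume "(c, d) \<in> ?P"
    from column_pairs_length[OF this]
    have "int (length c) - int (length d) = int n - 2 * int (length d)" by simp
    then show "monom (?G c d * (int (length d) + 1)) (Suc (length d)) +
        monom (?G c d * (int (length c) - int (length d))) (Suc (Suc (length d))) =
        andre_step n (monom (?G c d) (Suc (length d)))"
      by (simp add: andre_step_monom)
  qed
  finally show ?thesis by (simp add: tableaux_poly_def andre_step_sum case_prod_beta)
qed

theorem theorem20:
  fixes n :: nat
  assumes "n \<ge> 1"
  shows "andre_poly n =
    (\<Sum>T | T \<in> SYT n \<and> at_most_two_columns T.
       monom (int (g_index n T)) (n + 1 - length (shape T)))"
proof -
  \<comment> \<open>The induction starts at 0, where both polynomials are x; the hypothesis
    \<open>n \<ge> 1\<close> enters in the passage from words to \<open>andre_poly\<close>.\<close>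
  have "words_poly n = tableaux_poly n"
    by (induction n)
      (simp_all add: words_poly_0 tableaux_poly_0 words_poly_Suc tableaux_poly_Suc)
  then show ?thesis
    using assms by (simp add: andre_poly_eq_words_poly tableaux_poly_eq_sum_SYT)
qed

end
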